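(* Consider the status-updating semi-Markov decision process described in the context with a reliable channel, $p_s=1$, and let $\pi^*$ be the optimal policy. For any $s\in\mathcal S^\dagger$, we have $\pi^*(s)\ne\boldsymbol a_2$ when $\frac{C(\boldsymbol a_1)}{L(\boldsymbol a_1)}\le\frac{C(\boldsymbol a_2)}{L(\boldsymbol a_2)}$.
   Context: Parameters: positive integers $T_u$ and $T_u'$ (sizes in packets of a status update before and after preprocessing; one packet is sent per minislot), positive reals $l$ (bits per packet), $v$ (CPU cycles per bit), $f$ (CPU frequency), $\tau$ (minislot length), $\kappa$, $P$, and a weighting factor $\omega>0$. Put $T_p=\lceil T_u l v/(f\tau)\rceil$, $C_p=\kappa\tau f^3$, $C_u=P\tau$. The packet success probability is $p_s=1$. Actions: $\mathcal A=\{(0,0),(0,1),(1,1)\}$ (idle; transmit directly; preprocess then transmit). Durations in minislots: $L((0,0))=1$, $L((0,1))=T_u$, $L((1,1))=T_p+T_u'$. Energies: $C((0,0))=0$, $C((0,1))=T_uC_u$, $C((1,1))=T_pC_p+T_u'C_u$. States: the age of information (AoI) $s\in\mathcal S=\{1,2,\dots,\hat\delta\}$, where the upper limit $\hat\delta$ is assumed finite but arbitrarily large. $\mathcal S^\dagger=\{\min\{T_u,T_p+T_u'\},\dots,\hat\delta\}$ (smaller states are non-recurrent). Transitions $p(\cdot\mid s,\boldsymbol a)$ (deterministic since $p_s=1$): under $(0,0)$ the next state is $\min(s+1,\hat\delta)$; under $\boldsymbol a\in\{(0,1),(1,1)\}$ it is $\min(L(\boldsymbol a),\hat\delta)$. Cost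 of a time step: $R(s,\boldsymbol a)=\frac12(2s+L(\boldsymbol a)-1)L(\boldsymbol a)+\omega C(\boldsymbol a)$. The objective is to minimize, over stationary deterministic policies (attention is restricted to unichain policies), the average cost $\limsup_{T\to\infty}\mathbb E[\sum_{t=1}^T R(s(t),\boldsymbol a(t))]/\mathbb E[\sum_{t=1}^T L(\boldsymbol a(t))]$. Equivalent discrete-time MDP: fix $\epsilon\in(0,\min_{\boldsymbol a}L(\boldsymbol a)]$, and set $\bar R(s,\boldsymbol a)=R(s,\boldsymbol a)/L(\boldsymbol a)$, $\bar p(s'\mid s,\boldsymbol a)=\frac{\epsilon}{L(\boldsymbol a)}p(s'\mid s,\boldsymbol a)$ for $s'\ne s$, and $\bar p(s\mid s,\boldsymbol a)=1-\frac{\epsilon}{L(\boldsymbol a)}+\frac{\epsilon}{L(\boldsymbol a)}p(s\mid s,\boldsymbol a)$. The optimal average cost $\theta$ and the value function $V$ satisfy $\theta+V(s)=\min_{\boldsymbol a\in\mathcal A}\{\bar R(s,\boldsymbol a)+\sum_{s'\in\mathcal S}\bar p(s'\mid s,\boldsymbol a)V(s')\}$ for all $s\in\mathcal S$, and the optimal policy is $\pi^*(s)=\arg\min_{\boldsymbol a\in\mathcal A}\{\bar R(s,\boldsymbol a)+\sum_{s'\in\mathcal S}\bar p(s'\mid s,\boldsymbol a)V(s')\}$. $\boldsymbol a_1$ and $\boldsymbol a_2$ denote the two distinct elements of $\{(0,1),(1,1)\}$ with $L(\boldsymbol a_1)=\min$ and $L(\boldsymbol a_2)=\max$ of $L$ over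 $\{(0,1),(1,1)\}$.
   Formalization: If a_1 and a_2 have both equal duration L and equal energy C, they tie in the argmin and an optimal policy may use a_2; in that case only the existence of an optimal policy avoiding a_2 on S† is claimed. Otherwise every optimal policy avoids a_2. *)

theory Defs
  imports "HOL-Analysis.Analysis"
begin

record status_params =
  upd_len :: nat      (* T_u *)
  pre_len :: nat      (* T_u' *)
  pkt_bits :: real    (* l *)
  cyc_per_bit :: real (* v *)
  cpu_freq :: real    (* f *)
  slot_len :: real    (* tau *)
  cpu_coeff :: real   (* kappa *)
  tx_power :: real    (* P *)
  weight :: real      (* omega *)
  age_limit :: nat    (* delta hat *)
  step_size :: real   (* epsilon *)

type_synonym action = "nat \<times> nat"

definition actions :: "action set" where
  "actions = {(0, 0), (0, 1), (1, 1)}"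

definition proc_len :: "status_params \<Rightarrow> nat" where
  "proc_len M = nat \<lceil>real (upd_len M) * pkt_bits M * cyc_per_bit M / (cpu_freq M * slot_len M)\<rceil>"

definition proc_energy :: "status_params \<Rightarrow> real" where
  "proc_energy M = cpu_coeff M * slot_len M * cpu_freq M ^ 3"

definition tx_energy :: "status_params \<Rightarrow> real" where
  "tx_energy M = tx_power M * slot_len M"

(* The last branch of the next two definitions is meant for (1, 1); both are used on actions only. *)
definition duration :: "status_params \<Rightarrow> action \<Rightarrow> nat" where
  "duration M a =
     (if a = (0, 0) then 1 else if a = (0, 1) then upd_len M else proc_len M + pre_len M)"

definition energy :: "status_params \<Rightarrow> action \<Rightarrow> real" where
  "energy M a =
     (if a = (0, 0) then 0
      else if a = (0, 1) then real (upd_len M) * tx_energy M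
      else real (proc_len M) * proc_energy M + real (pre_len M) * tx_energy M)"

definition valid_params :: "status_params \<Rightarrow> bool" where
  "valid_params M \<longleftrightarrow>
     upd_len M > 0 \<and> pre_len M > 0 \<and> pkt_bits M > 0 \<and> cyc_per_bit M > 0 \<and> cpu_freq M > 0 \<and>
     slot_len M > 0 \<and> cpu_coeff M > 0 \<and> tx_power M > 0 \<and> weight M > 0 \<and> age_limit M > 0 \<and>
     0 < step_size M \<and> step_size M \<le> real (Min (duration M ` actions))"

definition states :: "status_params \<Rightarrow> nat set" where
  "states M = {1..age_limit M}"

definition rec_states :: "status_params \<Rightarrow> nat set" where
  "rec_states M = {min (upd_len M) (proc_len M + pre_len M)..age_limit M}"

(* Packets are always delivered (success probability 1), so the next state is deterministic. *)
definition next_age :: "status_params \<Rightarrow> nat \<Rightarrow> action \<Rightarrow> nat" where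
  "next_age M s a =
     (if a = (0, 0) then min (s + 1) (age_limit M) else min (duration M a) (age_limit M))"

definition trans :: "status_params \<Rightarrow> nat \<Rightarrow> action \<Rightarrow> nat \<Rightarrow> real" where
  "trans M s a s' = (if s' = next_age M s a then 1 else 0)"

definition cost :: "status_params \<Rightarrow> nat \<Rightarrow> action \<Rightarrow> real" where
  "cost M s a =
     1 / 2 * (2 * real s + real (duration M a) - 1) * real (duration M a) + weight M * energy M a"

definition cost_bar :: "status_params \<Rightarrow> nat \<Rightarrow> action \<Rightarrow> real" where
  "cost_bar M s a = cost M s a / real (duration M a)"

definition trans_bar :: "status_params \<Rightarrow> nat \<Rightarrow> action \<Rightarrow> nat \<Rightarrow> real" where
  "trans_bar M s a s' =
     (if s' = s
      then 1 - step_size M / real (duration M a)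
             + step_size M / real (duration M a) * trans M s a s
      else step_size M / real (duration M a) * trans M s a s')"

definition q_value :: "status_params \<Rightarrow> (nat \<Rightarrow> real) \<Rightarrow> nat \<Rightarrow> action \<Rightarrow> real" where
  "q_value M V s a = cost_bar M s a + (\<Sum>s'\<in>states M. trans_bar M s a s' * V s')"

definition optimality_equation :: "status_params \<Rightarrow> real \<Rightarrow> (nat \<Rightarrow> real) \<Rightarrow> bool" where
  "optimality_equation M \<theta> V \<longleftrightarrow>
     (\<forall>s\<in>states M. \<theta> + V s = Min (q_value M V s ` actions))"

definition optimal_policy ::
    "status_params \<Rightarrow> (nat \<Rightarrow> real) \<Rightarrow> (nat \<Rightarrow> action) \<Rightarrow> bool" where
  "optimal_policy M V \<pi> \<longleftrightarrow>
     (\<forall>s\<in>states M. is_arg_min (q_value M V s) (\<lambda>a. a \<in> actions) (\<pi> s))"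

(* The long-run objective. Transitions and policies are deterministic, so no expectation remains.
   The lemmas at the end show that a constant solving the optimality equation is the optimal
   average cost, and that optimal_policy yields policies attaining it. *)
definition age_at :: "status_params \<Rightarrow> (nat \<Rightarrow> action) \<Rightarrow> nat \<Rightarrow> nat \<Rightarrow> nat" where
  "age_at M \<pi> s0 t = ((\<lambda>s. next_age M s (\<pi> s)) ^^ t) s0"

definition average_cost :: "status_params \<Rightarrow> (nat \<Rightarrow> action) \<Rightarrow> nat \<Rightarrow> ereal" where
  "average_cost M \<pi> s0 =
     limsup (\<lambda>T. ereal ((\<Sum>t<T. cost M (age_at M \<pi> s0 t) (\<pi> (age_at M \<pi> s0 t)))
                 / (\<Sum>t<T. real (duration M (\<pi> (age_at M \<pi> s0 t))))))"

lemma proc_len_pos: "valid_params M \<Longrightarrow> proc_len M > 0"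
  by (simp add: valid_params_def proc_len_def)

lemma duration_pos: "valid_params M \<Longrightarrow> duration M a > 0"
  by (simp add: duration_def valid_params_def)

lemma next_age_in_states:
  assumes "valid_params M"
  shows "next_age M s a \<in> states M"
  using assms duration_pos[OF assms, of a] by (auto simp: next_age_def states_def valid_params_def)

lemma q_value_eq:
  assumes M: "valid_params M" and s: "s \<in> states M"
  shows "q_value M V s a =
    V s + (cost M s a + step_size M * (V (next_age M s a) - V s)) / real (duration M a)"
proof -
  let ?c = "step_size M / real (duration M a)"
  have *: "trans_bar M s a s' * V s' =
      (if s' = s then (1 - ?c) * V s else 0)
      + (if s' = next_age M s a then ?c * V (next_age M s a) else 0)" for s'
    by (auto simp: trans_bar_def trans_def algebra_simps)
  have "(\<Sum>s'\<in>states M. trans_bar M s a s' * V s') = (1 - ?c) * V s + ?c * V (next_age M s a)"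
    unfolding * sum.distrib using s next_age_in_states[OF M, of s a]
    by (simp add: states_def)
  then show ?thesis
    using duration_pos[OF M, of a] by (simp add: q_value_def cost_bar_def field_simps)
qed

lemma optimality_equation_ge:
  assumes M: "valid_params M" and V: "optimality_equation M \<theta> V"
    and s: "s \<in> states M" and a: "a \<in> actions"
  shows "\<theta> * real (duration M a) \<le> cost M s a + step_size M * (V (next_age M s a) - V s)"
proof -
  have "\<theta> + V s \<le> q_value M V s a"
    using V s a by (auto simp: optimality_equation_def actions_def)
  then show ?thesis
    unfolding q_value_eq[OF M s] using duration_pos[OF M, of a] by (simp add: field_simps)
qed

lemma optimality_equation_eq:
  assumes M: "valid_params M" and V: "optimality_equation M \<theta> V"
    and s: "s \<in> states M" and p: "optimal_policy M V \<pi>"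
  shows "\<theta> * real (duration M (\<pi> s)) =
    cost M s (\<pi> s) + step_size M * (V (next_age M s (\<pi> s)) - V s)"
proof -
  have "is_arg_min (q_value M V s) (\<lambda>a. a \<in> actions) (\<pi> s)"
    using p s by (simp add: optimal_policy_def)
  then have "Min (q_value M V s ` actions) = q_value M V s (\<pi> s)"
    by (intro Min_eqI) (auto simp: is_arg_min_def actions_def not_less)
  then have "\<theta> + V s = q_value M V s (\<pi> s)"
    using V s by (simp add: optimality_equation_def)
  then show ?thesis
    unfolding q_value_eq[OF M s] using duration_pos[OF M, of "\<pi> s"] by (simp add: field_simps)
qed

lemma age_at_in_states:
  assumes "valid_params M" "s0 \<in> states M"
  shows "age_at M \<pi> s0 t \<in> states M"
  using assms next_age_in_states by (cases t) (auto simp: age_at_def)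

lemma ratio_tendsto:
  assumes M: "valid_params M" and s0: "s0 \<in> states M"
  shows "(\<lambda>T. \<theta> + step_size M * (V s0 - V (age_at M \<pi> s0 T))
            / (\<Sum>t<T. real (duration M (\<pi> (age_at M \<pi> s0 t))))) \<longlonglongrightarrow> \<theta>"
proof -
  let ?D = "\<lambda>T. \<Sum>t<T. real (duration M (\<pi> (age_at M \<pi> s0 t)))"
  define B where "B = Max ((\<lambda>s. \<bar>V s0 - V s\<bar>) ` states M)"
  have B: "\<bar>V s0 - V (age_at M \<pi> s0 T)\<bar> \<le> B" for T
    unfolding B_def using age_at_in_states[OF M s0] by (intro Max_ge) (auto simp: states_def)
  have D: "real T \<le> ?D T" for T
    using sum_mono[of "{..<T}" "\<lambda>_. 1" "\<lambda>t. real (duration M (\<pi> (age_at M \<pi> s0 t)))"]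
      duration_pos[OF M] by (simp add: Suc_le_eq)
  have e: "step_size M > 0" using M by (simp add: valid_params_def)
  have "(\<lambda>T. step_size M * (V s0 - V (age_at M \<pi> s0 T)) / ?D T) \<longlonglongrightarrow> 0"
  proof (rule Lim_null_comparison)
    show "\<forall>\<^sub>F T in sequentially.
        norm (step_size M * (V s0 - V (age_at M \<pi> s0 T)) / ?D T) \<le> step_size M * B / real T"
      using eventually_gt_at_top[of 0]
    proof eventually_elim
      case (elim T)
      have "\<bar>step_size M * (V s0 - V (age_at M \<pi> s0 T))\<bar> \<le> step_size M * B"
        using B[of T] e by (simp add: abs_mult)
      then have "\<bar>step_size M * (V s0 - V (age_at M \<pi> s0 T))\<bar> / ?D T \<le> step_size M * B / real T"
        using D[of T] elim by (intro frac_le) auto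
      then show ?case using D[of T] by (simp add: abs_divide)
    qed
    show "(\<lambda>T. step_size M * B / real T) \<longlonglongrightarrow> 0" by (rule lim_const_over_n)
  qed
  from tendsto_add[OF tendsto_const[of \<theta>] this] show ?thesis by simp
qed

lemma average_cost_ge:
  assumes M: "valid_params M" and V: "optimality_equation M \<theta> V" and s0: "s0 \<in> states M"
    and p: "\<forall>s\<in>states M. \<pi> s \<in> actions"
  shows "ereal \<theta> \<le> average_cost M \<pi> s0"
proof -
  let ?s = "age_at M \<pi> s0"
  let ?D = "\<lambda>T. \<Sum>t<T. real (duration M (\<pi> (?s t)))"
  let ?C = "\<lambda>T. \<Sum>t<T. cost M (?s t) (\<pi> (?s t))"
  have sum: "\<theta> * ?D T + step_size M * (V s0 - V (?s T)) \<le> ?C T" for T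
  proof (induction T)
    case 0 then show ?case by (simp add: age_at_def)
  next
    case (Suc T)
    have "\<theta> * real (duration M (\<pi> (?s T)))
        \<le> cost M (?s T) (\<pi> (?s T)) + step_size M * (V (?s (Suc T)) - V (?s T))"
      using optimality_equation_ge[OF M V age_at_in_states[OF M s0]] p age_at_in_states[OF M s0]
      by (simp add: age_at_def)
    with Suc show ?case by (simp add: algebra_simps)
  qed
  have "\<forall>\<^sub>F T in sequentially.
      ereal (\<theta> + step_size M * (V s0 - V (?s T)) / ?D T) \<le> ereal (?C T / ?D T)"
    using eventually_gt_at_top[of 0]
  proof eventually_elim
    case (elim T)
    have "?D T > 0" using elim duration_pos[OF M] by (intro sum_pos) auto
    then have "\<theta> + step_size M * (V s0 - V (?s T)) / ?D T
        = (\<theta> * ?D T + step_size M * (V s0 - V (?s T))) / ?D T"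
      by (simp add: add_divide_distrib)
    also have "\<dots> \<le> ?C T / ?D T"
      using sum[of T] \<open>?D T > 0\<close> by (intro divide_right_mono) auto
    finally show ?case by simp
  qed
  then have "limsup (\<lambda>T. ereal (\<theta> + step_size M * (V s0 - V (?s T)) / ?D T)) \<le> average_cost M \<pi> s0"
    unfolding average_cost_def by (rule Limsup_mono)
  moreover have "limsup (\<lambda>T. ereal (\<theta> + step_size M * (V s0 - V (?s T)) / ?D T)) = ereal \<theta>"
    using ratio_tendsto[OF M s0] by (intro lim_imp_Limsup) auto
  ultimately show ?thesis by simp
qed

lemma average_cost_optimal_policy:
  assumes M: "valid_params M" and V: "optimality_equation M \<theta> V" and s0: "s0 \<in> states M"
    and p: "optimal_policy M V \<pi>"
  shows "average_cost M \<pi> s0 = ereal \<theta>"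
proof -
  let ?s = "age_at M \<pi> s0"
  let ?D = "\<lambda>T. \<Sum>t<T. real (duration M (\<pi> (?s t)))"
  let ?C = "\<lambda>T. \<Sum>t<T. cost M (?s t) (\<pi> (?s t))"
  have sum: "?C T = \<theta> * ?D T + step_size M * (V s0 - V (?s T))" for T
  proof (induction T)
    case 0 then show ?case by (simp add: age_at_def)
  next
    case (Suc T)
    have "\<theta> * real (duration M (\<pi> (?s T)))
        = cost M (?s T) (\<pi> (?s T)) + step_size M * (V (?s (Suc T)) - V (?s T))"
      using optimality_equation_eq[OF M V age_at_in_states[OF M s0] p] by (simp add: age_at_def)
    with Suc show ?case by (simp add: algebra_simps)
  qed
  have "\<forall>\<^sub>F T in sequentially.
      \<theta> + step_size M * (V s0 - V (?s T)) / ?D T = ?C T / ?D T"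
    using eventually_gt_at_top[of 0]
  proof eventually_elim
    case (elim T)
    have "?D T > 0" using elim duration_pos[OF M] by (intro sum_pos) auto
    then show ?case unfolding sum[of T] by (simp add: add_divide_distrib)
  qed
  then have "(\<lambda>T. ?C T / ?D T) \<longlonglongrightarrow> \<theta>"
    using ratio_tendsto[OF M s0] by (rule Lim_transform_eventually[rotated])
  then show ?thesis
    unfolding average_cost_def by (intro lim_imp_Limsup) auto
qed

end

theory Submission
  imports Defs
begin

text \<open>
  The value function is nondecreasing in the age, by downward induction: raising the age by one
  raises the cost of every action, and the successor ages stay ordered. If \<open>a2\<close> were optimal at
  some \<open>s \<ge> L(a1)\<close>, then comparing the optimality equation for \<open>a2\<close> divided by \<open>L(a2)\<close> with the
  optimality inequality for \<open>a1\<close> divided by \<open>L(a1)\<close> would leave a holding cost gap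
  \<open>(L(a2) - L(a1)) / 2\<close> that the energy hypothesis and the monotonicity of the value function
  do not allow \<open>a2\<close> to recover.
\<close>

lemma optimal_policy_exists: "\<exists>\<pi>. optimal_policy M V \<pi>"
proof -
  have "\<exists>a. is_arg_min (q_value M V s) (\<lambda>a. a \<in> actions) a" for s
    using ex_is_arg_min_if_finite[of actions "q_value M V s"] by (simp add: actions_def)
  then show ?thesis unfolding optimal_policy_def by metis
qed

lemma optimal_policy_in_actions:
  "optimal_policy M V \<pi> \<Longrightarrow> s \<in> states M \<Longrightarrow> \<pi> s \<in> actions"
  by (simp add: optimal_policy_def is_arg_min_def)

lemma optimality_equation_mono_Suc:
  assumes M: "valid_params M" and V: "optimality_equation M \<theta> V"
    and "1 \<le> s" "Suc s \<le> age_limit M"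
  shows "V s \<le> V (Suc s)"
  using assms(3,4)
proof (induction "age_limit M - s" arbitrary: s rule: less_induct)
  case less
  obtain \<pi> where p: "optimal_policy M V \<pi>" using optimal_policy_exists by blast
  have s: "s \<in> states M" and s': "Suc s \<in> states M"
    using less.prems by (auto simp: states_def)
  \<comment> \<open>The action optimal at the larger age is tried at both ages: the optimality
    equation is tight for it at \<open>Suc s\<close> and an inequality at \<open>s\<close>.\<close>
  define a where "a = \<pi> (Suc s)"
  have e: "step_size M > 0" using M by (simp add: valid_params_def)
  have next_le: "V (next_age M s a) \<le> V (next_age M (Suc s) a)"
  \<comment> \<open>Only idling with room below the cap separates the successors, into
    \<open>s + 1\<close> and \<open>s + 2\<close>, where the induction hypothesis applies. An update
    forgets the current age, and idling with \<open>Suc s\<close> at the cap sends both ages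
    there.\<close>
  proof (cases "a = (0, 0) \<and> Suc (Suc s) \<le> age_limit M")
    case True
    then show ?thesis using less.hyps[of "Suc s"] less.prems by (simp add: next_age_def diff_less_mono2)
  next
    case False
    then have "next_age M (Suc s) a = next_age M s a"
      using less.prems by (auto simp: next_age_def)
    then show ?thesis by simp
  qed
  have cost_le: "cost M s a \<le> cost M (Suc s) a"
    by (simp add: cost_def mult_right_mono)
  have "cost M (Suc s) a + step_size M * (V (next_age M (Suc s) a) - V (Suc s))
      \<le> cost M s a + step_size M * (V (next_age M s a) - V s)"
    using optimality_equation_ge[OF M V s, of a] optimality_equation_eq[OF M V s' p]
      optimal_policy_in_actions[OF p s'] by (simp add: a_def)
  moreover have "step_size M * V (next_age M s a) \<le> step_size M * V (next_age M (Suc s) a)"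
    using next_le e by simp
  ultimately have "step_size M * V s \<le> step_size M * V (Suc s)"
    using cost_le by (simp add: algebra_simps)
  then show ?case using e by simp
qed

lemma optimality_equation_mono:
  assumes M: "valid_params M" and V: "optimality_equation M \<theta> V"
    and "1 \<le> s" "s \<le> t" "t \<le> age_limit M"
  shows "V s \<le> V t"
  using assms(4,5)
proof (induction t rule: dec_induct)
  case (step n)
  then show ?case using optimality_equation_mono_Suc[OF M V, of n] assms(3) by simp
qed simp

text \<open>\<open>differ\<close> rules out a full tie, in which \<open>a\<close> and
  \<open>b\<close> have the same Q-value and a minimiser may pick either.\<close>

lemma longer_update_not_optimal:
  assumes M: "valid_params M" and V: "optimality_equation M \<theta> V" and p: "optimal_policy M V \<pi>"
    and a: "a \<in> actions" "a \<noteq> (0, 0)" and b: "b \<noteq> (0, 0)"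
    and dur: "duration M a \<le> duration M b"
    and energy: "energy M a / real (duration M a) \<le> energy M b / real (duration M b)"
    and differ: "\<not> (duration M a = duration M b \<and> energy M a = energy M b)"
    and s: "duration M a \<le> s" "s \<le> age_limit M"
  shows "\<pi> s \<noteq> b"
proof
  assume opt: "\<pi> s = b"
  \<comment> \<open>Scaling by the step size undoes the discretisation: \<open>W\<close> satisfies
    the semi-Markov equation, with \<open>\<theta>\<close> multiplied by the duration.\<close>
  define W where "W x = step_size M * V x" for x
  define A where "A = real (duration M a)"
  define B where "B = real (duration M b)"
  define n where "n = next_age M s b"
  have pos: "A > 0" "B > 0" "duration M a > 0" "weight M > 0" "step_size M > 0"
    using duration_pos[OF M] M by (auto simp: A_def B_def valid_params_def)
  have st: "s \<in> states M" using s pos by (simp add: states_def)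
  have na: "next_age M s a = duration M a"
    using a s by (simp add: next_age_def)
  \<comment> \<open>The cap may truncate the reset age of \<open>b\<close>, but not below
    \<open>duration M a\<close>, since
    \<open>duration M a \<le> s \<le> age_limit M\<close>.\<close>
  have n: "duration M a \<le> n" "n \<le> age_limit M"
    using b dur s by (auto simp: n_def next_age_def)
  have W: "W (duration M a) \<le> W s" "W (duration M a) \<le> W n"
    using optimality_equation_mono[OF M V _ s(1) s(2)] optimality_equation_mono[OF M V _ n] pos
    by (auto simp: W_def)
  have AB: "A \<le> B" using dur by (simp add: A_def B_def)
  have "\<theta> * A \<le> cost M s a + W (duration M a) - W s"
    using optimality_equation_ge[OF M V st a(1)] na
    by (simp add: A_def W_def right_diff_distrib)
  then have "\<theta> \<le> (cost M s a + W (duration M a) - W s) / A"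
    using pos by (simp add: pos_le_divide_eq)
  also have "\<dots> = real s + (A - 1) / 2 + weight M * (energy M a / A) - (W s - W (duration M a)) / A"
    using pos by (simp add: cost_def flip: A_def) (simp add: field_simps)
  finally have ineq: "\<theta> \<le> \<dots>" .
  have "\<theta> * B = cost M s b + W n - W s"
    using optimality_equation_eq[OF M V st p] opt
    by (simp add: B_def W_def n_def right_diff_distrib)
  then have "\<theta> = (cost M s b + W n - W s) / B"
    using pos by (simp add: eq_divide_eq)
  also have "\<dots> = real s + (B - 1) / 2 + weight M * (energy M b / B) - (W s - W n) / B"
    using pos by (simp add: cost_def flip: B_def) (simp add: field_simps)
  finally have eq: "\<theta> = \<dots>" .
  have "(W s - W n) / B \<le> (W s - W (duration M a)) / B"
    using W pos by (intro divide_right_mono) auto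
  also have "\<dots> \<le> (W s - W (duration M a)) / A"
    using W pos AB by (intro divide_left_mono) auto
  finally have recover: "(W s - W n) / B \<le> (W s - W (duration M a)) / A" .
  have energy': "weight M * (energy M a / A) \<le> weight M * (energy M b / B)"
    using energy pos unfolding A_def B_def by (intro mult_left_mono) auto
  \<comment> \<open>The two bounds on \<open>\<theta>\<close> give
    \<open>(B - A) / 2 \<le> 0\<close>. With equal durations the same comparison forces equal
    energies, against \<open>differ\<close>.\<close>
  have "A = B" using ineq eq recover energy' AB by argo
  moreover from this have "weight M * (energy M a / A) = weight M * (energy M b / B)"
    using ineq eq recover energy' by argo
  ultimately show False using differ pos by (simp add: A_def B_def)
qed

lemma q_value_cong:
  assumes "duration M a = duration M b" "energy M a = energy M b" "a \<noteq> (0, 0)" "b \<noteq> (0, 0)"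
  shows "q_value M V s a = q_value M V s b"
proof -
  have "next_age M s a = next_age M s b" for s using assms by (simp add: next_age_def)
  then show ?thesis
    using assms by (simp add: q_value_def cost_bar_def cost_def trans_bar_def trans_def cong: if_cong)
qed

text \<open>Minimisers need not be unique. If the updates agree in duration and energy,
  \<open>a2\<close> ties with \<open>a1\<close> everywhere, so the claim for every optimal policy
  excludes this case; the second conjunct says that the tie can be broken in favour of
  \<open>a1\<close>.\<close>

theorem lemma7:
  fixes M :: status_params and \<theta> :: real and V :: "nat \<Rightarrow> real" and a1 a2 :: action
  assumes "valid_params M"
    and "optimality_equation M \<theta> V"
    and "a1 \<noteq> a2" and "{a1, a2} = {(0, 1), (1, 1)}"
    and "duration M a1 = Min (duration M ` {(0, 1), (1, 1)})"
    and "duration M a2 = Max (duration M ` {(0, 1), (1, 1)})"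
    and "energy M a1 / real (duration M a1) \<le> energy M a2 / real (duration M a2)"
  shows "(\<forall>\<pi>. optimal_policy M V \<pi> \<and>
              \<not> (duration M a1 = duration M a2 \<and> energy M a1 = energy M a2)
            \<longrightarrow> (\<forall>s \<in> rec_states M. \<pi> s \<noteq> a2)) \<and>
         (\<exists>\<pi>. optimal_policy M V \<pi> \<and> (\<forall>s \<in> rec_states M. \<pi> s \<noteq> a2))"
proof -
  have a1: "a1 \<in> actions" "a1 \<noteq> (0, 0)" and a2: "a2 \<noteq> (0, 0)"
    using assms(3,4) by (auto simp: actions_def doubleton_eq_iff)
  have dur: "duration M a1 = min (upd_len M) (proc_len M + pre_len M)"
    using assms(5) by (simp add: duration_def)
  have le: "duration M a1 \<le> duration M a2"
    using assms(5,6) by simp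
  have strict: "\<forall>s\<in>rec_states M. \<pi> s \<noteq> a2"
    if "optimal_policy M V \<pi>" "\<not> (duration M a1 = duration M a2 \<and> energy M a1 = energy M a2)" for \<pi>
    using longer_update_not_optimal[OF assms(1,2) that(1) a1 a2 le assms(7) that(2)] dur
    by (simp add: rec_states_def)
  obtain \<pi> where p: "optimal_policy M V \<pi>" using optimal_policy_exists by blast
  have "\<exists>\<pi>. optimal_policy M V \<pi> \<and> (\<forall>s\<in>rec_states M. \<pi> s \<noteq> a2)"
  proof (cases "duration M a1 = duration M a2 \<and> energy M a1 = energy M a2")
    case True
    then have q: "q_value M V s a1 = q_value M V s a2" for s
      using q_value_cong a1 a2 by blast
    \<comment> \<open>Swapping \<open>a2\<close> for \<open>a1\<close> preserves every Q-value,
      hence optimality.\<close>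
    define \<pi>' where "\<pi>' s = (if \<pi> s = a2 then a1 else \<pi> s)" for s
    have "optimal_policy M V \<pi>'"
      using p a1 q by (auto simp: optimal_policy_def is_arg_min_def \<pi>'_def)
    moreover have "\<pi>' s \<noteq> a2" for s using assms(3) by (simp add: \<pi>'_def)
    ultimately show ?thesis by blast
  next
    case False
    then show ?thesis using p strict by blast
  qed
  with strict show ?thesis by blast
qed

end
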